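(* For any integers $p\ge2$ and $n\ge1$ there is an $(n+p+1)$-point metric space $(X,d)$ such that the matrix $T:=\Pi_N S(X)\Pi_N$, $N:=n+p+1$, has signature $s_+(T)=p$, $s_-(T)=n$.
   Context: For a real symmetric matrix $A$, $s_+(A)$ and $s_-(A)$ denote the numbers of strictly positive, respectively strictly negative, eigenvalues of $A$, counted with multiplicity. For a finite metric space $X=\{x_1,\dots,x_N\}$ with distance $d$, $S(X):=\left(-\tfrac12 d^2(x_i,x_j)\right)_{i,j=1}^N$. Further, $\Pi_N:=\mathrm{Id}_N-\frac1N\mathbf 1_N\mathbf 1_N^T\in\mathbb R^{N\times N}$, where $\mathrm{Id}_N$ is the identity matrix and $\mathbf 1_N=(1,\dots,1)^T\in\mathbb R^N$. *)

theory Defs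
  imports "HOL-Analysis.Abstract_Metric_Spaces" "Jordan_Normal_Form.Char_Poly"
begin

text \<open>
  Multiplicities are algebraic ones, i.e. orders of roots of the characteristic polynomial;
  for the real symmetric matrices considered here they agree with the geometric ones.
\<close>

definition s_plus :: "real mat \<Rightarrow> nat" where
  "s_plus A = (\<Sum>e | eigenvalue A e \<and> e > 0. order e (char_poly A))"

definition s_minus :: "real mat \<Rightarrow> nat" where
  "s_minus A = (\<Sum>e | eigenvalue A e \<and> e < 0. order e (char_poly A))"

text \<open>The points of the space are enumerated as \<open>x 0, \<dots>, x (N - 1)\<close>.\<close>

definition S_mat :: "nat \<Rightarrow> (nat \<Rightarrow> 'a) \<Rightarrow> ('a \<Rightarrow> 'a \<Rightarrow> real) \<Rightarrow> real mat" where
  "S_mat N x d = mat N N (\<lambda>(i, j). - (1 / 2) * (d (x i) (x j))\<^sup>2)"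

definition ones_col :: "nat \<Rightarrow> real mat" where
  "ones_col N = mat N 1 (\<lambda>_. 1)"

definition Pi_mat :: "nat \<Rightarrow> real mat" where
  "Pi_mat N = 1\<^sub>m N - (1 / real N) \<cdot>\<^sub>m (ones_col N * (ones_col N)\<^sup>T)"

end

theory Submission
  imports Defs
begin

text \<open>
  Take \<open>N\<close> points spanning \<open>\<real>\<^sup>p\<close> affinely with no three of them collinear, and subtract a small
  \<open>\<epsilon> > 0\<close> from all squared distances. As all triangle inequalities were strict, the result is still
  a metric. Centering turns the squared Euclidean distances into the Gram matrix of the points,
  of rank \<open>p\<close>, and the subtraction into \<open>- \<epsilon>/2\<close> times the identity on the complement of the
  constants; so the \<open>p\<close> positive eigenvalues persist and the other \<open>n\<close> become \<open>- \<epsilon>/2\<close>.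
  For an explicit spectrum the coordinates are the discrete orthonormal polynomials of degrees
  \<open>1, \<dots>, p\<close> on \<open>{0, \<dots>, N - 1}\<close>; the first two already place the points on a parabola.
\<close>

section \<open>Discrete orthonormal polynomials\<close>

text \<open>A nonzero polynomial of degree below \<open>N\<close> cannot vanish at all of
  \<open>0, ..., N - 1\<close>. This is the definiteness of the discrete inner product that
  Gram-Schmidt needs.\<close>

lemma sum_squares_poly_pos:
  fixes r :: "real poly"
  assumes "r \<noteq> 0" and "degree r < N"
  shows "(\<Sum>i<N. (poly r (real i))\<^sup>2) > 0"
proof -
  have "\<exists>i<N. poly r (real i) \<noteq> 0"
  proof (rule ccontr)
    assume "\<not> (\<exists>i<N. poly r (real i) \<noteq> 0)"
    then have sub: "real ` {..<N} \<subseteq> {x. poly r x = 0}" by auto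
    have "N = card (real ` {..<N})" by (simp add: card_image)
    also have "\<dots> \<le> card {x. poly r x = 0}"
      by (rule card_mono[OF poly_roots_finite[OF assms(1)] sub])
    also have "\<dots> \<le> degree r" by (rule card_poly_roots_bound[OF assms(1)])
    finally show False using assms(2) by simp
  qed
  then obtain i where "i < N" "poly r (real i) \<noteq> 0" by blast
  then show ?thesis by (intro sum_pos2[of _ i]) auto
qed

text \<open>Gram-Schmidt applied to the monomials, by induction on the number \<open>m\<close> of
  polynomials for fixed \<open>N\<close>. The bound on \<open>m\<close> keeps each new degree below
  \<open>N\<close>, so that the norm to divide by is positive.\<close>

lemma discrete_orthonormal_polys_aux:
  assumes "m \<le> N"
  shows "\<exists>q :: nat \<Rightarrow> real poly. (\<forall>k<m. degree (q k) = k) \<and>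
    (\<forall>j<m. \<forall>k<m. (\<Sum>i<N. poly (q j) (real i) * poly (q k) (real i)) = (if j = k then 1 else 0))"
  using assms
proof (induction m)
  case 0
  then show ?case by simp
next
  case (Suc m)
  define ip where "ip f g = (\<Sum>i<N. poly f (real i) * poly g (real i))" for f g :: "real poly"
  from Suc obtain q :: "nat \<Rightarrow> real poly" where
    deg: "\<And>k. k < m \<Longrightarrow> degree (q k) = k" and
    orth: "\<And>j k. j < m \<Longrightarrow> k < m \<Longrightarrow> ip (q j) (q k) = (if j = k then 1 else 0)"
    unfolding ip_def by (auto simp: Suc_le_eq)
  have ip_commute: "ip f g = ip g f" for f g by (simp add: ip_def mult.commute)
  \<comment> \<open>The projection of the monomial of degree \<open>m\<close> onto the earlier
    polynomials. All of these have degree below \<open>m\<close>, so \<open>r\<close> is monic of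
    degree \<open>m\<close>.\<close>
  define s where "s = (\<Sum>j<m. Polynomial.smult (ip (monom 1 m) (q j)) (q j))"
  define r where "r = monom 1 m - s"
  have coeff_s: "coeff s l = 0" if "l \<ge> m" for l
    unfolding s_def coeff_sum using that deg by (intro sum.neutral) (auto intro!: coeff_eq_0)
  have coeff_r: "coeff r m = 1" by (simp add: r_def coeff_s)
  have "degree r \<le> m" by (rule degree_le) (auto simp: r_def coeff_s)
  with coeff_r have deg_r: "degree r = m"
    by (metis le_antisym le_degree zero_neq_one)
  have "r \<noteq> 0" using coeff_r by auto
  have pos: "ip r r > 0"
    using sum_squares_poly_pos[OF \<open>r \<noteq> 0\<close>, of N] deg_r Suc.prems
    by (simp add: ip_def power2_eq_square)
  have ip_r: "ip r (q k) = 0" if "k < m" for k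
  proof -
    have "ip s (q k) = (\<Sum>i<N. \<Sum>j<m. ip (monom 1 m) (q j) * (poly (q j) (real i) * poly (q k) (real i)))"
      unfolding ip_def[of s] by (simp add: s_def poly_sum sum_distrib_right mult.assoc)
    also have "\<dots> = (\<Sum>j<m. ip (monom 1 m) (q j) * ip (q j) (q k))"
      by (subst sum.swap) (simp add: ip_def[of "q _"] sum_distrib_left)
    also have "\<dots> = (\<Sum>j<m. if j = k then ip (monom 1 m) (q j) else 0)"
      using that orth by (intro sum.cong) auto
    also have "\<dots> = ip (monom 1 m) (q k)" using that by simp
    finally show ?thesis
      by (simp add: ip_def r_def sum_subtractf left_diff_distrib)
  qed
  define q' where "q' = q(m := Polynomial.smult (1 / sqrt (ip r r)) r)"
  have ip_smult: "ip (Polynomial.smult c f) g = c * ip f g" for c f g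
    by (simp add: ip_def sum_distrib_left mult_ac)
  have norm: "ip (q' m) (q' m) = 1"
    using pos by (simp add: q'_def ip_smult ip_commute[of r "Polynomial.smult _ _"] field_simps)
  have zero: "ip (q' m) (q' k) = 0" if "k < m" for k
    using that by (simp add: q'_def ip_smult ip_r)
  have "degree (q' k) = k" if "k < Suc m" for k
    using that deg deg_r pos by (auto simp: q'_def less_Suc_eq)
  moreover have "ip (q' j) (q' k) = (if j = k then 1 else 0)" if "j < Suc m" "k < Suc m" for j k
  proof -
    consider "j = m" "k = m" | "j = m" "k < m" | "j < m" "k = m" | "j < m" "k < m"
      using \<open>j < Suc m\<close> \<open>k < Suc m\<close> unfolding less_Suc_eq by blast
    then show ?thesis
    proof cases
      case 3
      then show ?thesis using zero[of j] by (simp add: ip_commute)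
    next
      case 4
      then show ?thesis using orth by (simp add: q'_def)
    qed (use norm zero in auto)
  qed
  ultimately show ?case unfolding ip_def by blast
qed

lemmas discrete_orthonormal_polys = discrete_orthonormal_polys_aux[OF order_refl]

section \<open>The spectrum of the centered matrix\<close>

lemma Pi_mat_carrier: "Pi_mat N \<in> carrier_mat N N"
  by (rule carrier_matI) (simp_all add: Pi_mat_def ones_col_def)

lemma Pi_mat_index:
  assumes "i < N" "j < N"
  shows "Pi_mat N $$ (i, j) = (if i = j then 1 else 0) - 1 / real N"
  using assms by (simp add: Pi_mat_def ones_col_def scalar_prod_def)

lemma index_mult_mat_sum:
  assumes "A \<in> carrier_mat m n" "B \<in> carrier_mat n l" "i < m" "j < l"
  shows "(A * B) $$ (i, j) = (\<Sum>k<n. A $$ (i, k) * B $$ (k, j))"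
  using assms by (simp add: scalar_prod_def atLeast0LessThan)

lemma Pi_mat_mult_index:
  assumes "M \<in> carrier_mat N l" "i < N" "k < l"
  shows "(Pi_mat N * M) $$ (i, k) = M $$ (i, k) - (\<Sum>j<N. M $$ (j, k)) / real N"
proof -
  have "(Pi_mat N * M) $$ (i, k) = (\<Sum>j<N. Pi_mat N $$ (i, j) * M $$ (j, k))"
    by (rule index_mult_mat_sum[OF Pi_mat_carrier assms])
  also have "\<dots> = (\<Sum>j<N. (if i = j then M $$ (j, k) else 0) - M $$ (j, k) / real N)"
    using assms(2) by (intro sum.cong) (auto simp: Pi_mat_index left_diff_distrib)
  also have "\<dots> = M $$ (i, k) - (\<Sum>j<N. M $$ (j, k)) / real N"
    using assms(2) by (simp add: sum_subtractf sum_divide_distrib)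
  finally show ?thesis .
qed

text \<open>For square \<open>Q\<close> the left inverse \<open>Q\<^sup>T\<close> is also a right
  inverse, so an orthonormal basis of eigenvectors gives a similarity between \<open>T\<close> and
  \<open>D\<close>.\<close>

lemma char_poly_eigenbasis:
  fixes T Q D :: "real mat"
  assumes T: "T \<in> carrier_mat N N" and Q: "Q \<in> carrier_mat N N" and D: "D \<in> carrier_mat N N"
    and orth: "Q\<^sup>T * Q = 1\<^sub>m N" and eig: "T * Q = Q * D"
  shows "char_poly T = char_poly D"
proof (rule char_poly_similar)
  have Qt: "Q\<^sup>T \<in> carrier_mat N N" using Q by simp
  have QQ: "Q * Q\<^sup>T = 1\<^sub>m N" by (rule mat_mult_left_right_inverse[OF Qt Q orth])
  have "T = T * (Q * Q\<^sup>T)" using T QQ by simp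
  also have "\<dots> = T * Q * Q\<^sup>T" by (rule assoc_mult_mat[OF T Q Qt, symmetric])
  finally have "T = Q * D * Q\<^sup>T" by (simp add: eig)
  then show "similar_mat T D"
    unfolding similar_mat_def using similar_mat_witI[OF QQ orth _ T D Q Qt] by blast
qed

text \<open>The vectors \<open>u k\<close> are themselves an eigenbasis. Expand the squares and
  apply the matrix to \<open>u k\<close> with \<open>k > 0\<close>: terms in \<open>i\<close> alone
  vanish because \<open>u k\<close> sums to zero, terms in \<open>j\<close> alone give a constant
  vector that the outer projection removes, and the cross terms give \<open>u k\<close> exactly when
  \<open>k\<close> is at most \<open>p\<close>, by orthonormality.\<close>

lemma char_poly_centered:
  fixes u :: "nat \<Rightarrow> nat \<Rightarrow> real" and e c :: real
  assumes orth: "\<And>j k. j < N \<Longrightarrow> k < N \<Longrightarrow> (\<Sum>i<N. u j i * u k i) = (if j = k then 1 else 0)"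
    and const: "\<And>i. u 0 i = c" and N: "N = n + p + 1"
  defines "S \<equiv> mat N N (\<lambda>(i, j). - (1 / 2) * (if i = j then 0 else (\<Sum>m=1..p. (u m i - u m j)\<^sup>2) - e))"
  shows "char_poly (Pi_mat N * S * Pi_mat N) = [:0, 1:] * [:- (1 - e / 2), 1:] ^ p * [:e / 2, 1:] ^ n"
proof -
  \<comment> \<open>The eigenvalues: constants are annihilated, the \<open>p\<close> coordinate
    vectors get 1 from the Gram matrix, and every nonconstant vector is shifted by
    \<open>- e / 2\<close>.\<close>
  define l where "l k = (if k = 0 then 0 else if k \<le> p then 1 - e / 2 else - e / 2)" for k
  define Q where "Q = mat N N (\<lambda>(i, k). u k i)"
  define D where "D = mat N N (\<lambda>(i, k). if i = k then l k else 0)"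
  define P where "P = Pi_mat N"
  have car: "P \<in> carrier_mat N N" "S \<in> carrier_mat N N" "Q \<in> carrier_mat N N" "D \<in> carrier_mat N N"
    by (auto simp: P_def Pi_mat_carrier S_def Q_def D_def)
  have "c \<noteq> 0" using orth[of 0 0] N by (auto simp: const)
  have sum0: "(\<Sum>i<N. u k i) = 0" if "1 \<le> k" "k < N" for k
    using orth[of 0 k] that \<open>c \<noteq> 0\<close> N by (simp add: const flip: sum_distrib_left)

  have PQ: "(P * Q) $$ (i, k) = (if k = 0 then 0 else u k i)" if "i < N" "k < N" for i k
    using that sum0[of k] Pi_mat_mult_index[OF car(3) that]
    by (auto simp: P_def Q_def const)

  \<comment> \<open>The constant \<open>b\<close> may depend on the column \<open>k\<close> but not
    on the row \<open>i\<close>; it lies in the kernel of the left factor \<open>P\<close>.\<close>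
  have SPQ: "\<exists>b. \<forall>i<N. (S * (P * Q)) $$ (i, k) = b + l k * u k i" if k: "k < N" for k
  proof (cases "k = 0")
    case True
    have "(S * (P * Q)) $$ (i, k) = 0" if "i < N" for i
      using that k car by (subst index_mult_mat_sum[where n = N and m = N and l = N])
        (auto simp: PQ True simp del: index_mult_mat)
    then show ?thesis by (intro exI[of _ 0]) (simp add: l_def True)
  next
    case False
    define b where "b = - (1 / 2) * (\<Sum>m=1..p. \<Sum>j<N. (u m j)\<^sup>2 * u k j)"
    have "(S * (P * Q)) $$ (i, k) = b + l k * u k i" if i: "i < N" for i
    proof -
      \<comment> \<open>The zero diagonal is absorbed by writing the perturbation as
        \<open>e / 2\<close> times the all-ones matrix minus \<open>e / 2\<close> times the
        identity; the former annihilates \<open>u k\<close>.\<close>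
      have S_index: "S $$ (i, j) = - (1 / 2) * (\<Sum>m=1..p. (u m i - u m j)\<^sup>2) + e / 2
          - (if i = j then e / 2 else 0)" if "j < N" for j
        using i that by (simp add: S_def field_simps)
      have inner: "(\<Sum>j<N. (u m i - u m j)\<^sup>2 * u k j)
          = (\<Sum>j<N. (u m j)\<^sup>2 * u k j) - 2 * (if m = k then u k i else 0)" if "m \<in> {1..p}" for m
      proof -
        have "(\<Sum>j<N. (u m i - u m j)\<^sup>2 * u k j)
            = (\<Sum>j<N. (u m i)\<^sup>2 * u k j + (u m j)\<^sup>2 * u k j - 2 * u m i * (u m j * u k j))"
          by (intro sum.cong) (auto simp: power2_eq_square algebra_simps)
        also have "\<dots> = (u m i)\<^sup>2 * (\<Sum>j<N. u k j) + (\<Sum>j<N. (u m j)\<^sup>2 * u k j)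
            - 2 * u m i * (\<Sum>j<N. u m j * u k j)"
          by (simp only: sum.distrib sum_subtractf sum_distrib_left)
        finally show ?thesis
          using sum0[of k] orth[of m k] that k False N by auto
      qed
      have "(S * (P * Q)) $$ (i, k) = (\<Sum>j<N. S $$ (i, j) * u k j)"
        using i k False car by (subst index_mult_mat_sum[where n = N and m = N and l = N])
          (auto simp: PQ simp del: index_mult_mat)
      also have "\<dots> = (\<Sum>j<N. - (1 / 2) * ((\<Sum>m=1..p. (u m i - u m j)\<^sup>2) * u k j) + e / 2 * u k j
          - (if i = j then e / 2 * u k j else 0))"
        by (intro sum.cong) (auto simp: S_index algebra_simps)
      also have "\<dots> = - (1 / 2) * (\<Sum>j<N. (\<Sum>m=1..p. (u m i - u m j)\<^sup>2) * u k j)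
          + e / 2 * (\<Sum>j<N. u k j) - e / 2 * u k i"
        using i by (simp add: sum.distrib sum_subtractf sum_distrib_left sum_negf)
      also have "(\<Sum>j<N. (\<Sum>m=1..p. (u m i - u m j)\<^sup>2) * u k j)
          = (\<Sum>m=1..p. \<Sum>j<N. (u m i - u m j)\<^sup>2 * u k j)"
        unfolding sum_distrib_right by (rule sum.swap)
      also have "\<dots> = (\<Sum>m=1..p. (\<Sum>j<N. (u m j)\<^sup>2 * u k j) - 2 * (if m = k then u k i else 0))"
        by (intro sum.cong inner refl)
      also have "\<dots> = (\<Sum>m=1..p. \<Sum>j<N. (u m j)\<^sup>2 * u k j) - 2 * (if k \<le> p then u k i else 0)"
        using False by (simp add: sum_subtractf sum_distrib_left[symmetric])
      finally show ?thesis
        using sum0[of k] k False by (auto simp: b_def l_def algebra_simps)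
    qed
    then show ?thesis by blast
  qed

  have eig: "P * S * P * Q = Q * D"
  proof (rule eq_matI)
    fix i k assume "i < dim_row (Q * D)" "k < dim_col (Q * D)"
    then have i: "i < N" and k: "k < N" by (auto simp: Q_def D_def)
    from SPQ[OF k] obtain b where b: "\<And>i. i < N \<Longrightarrow> (S * (P * Q)) $$ (i, k) = b + l k * u k i"
      by blast
    have "P * S * P * Q = P * (S * (P * Q))"
      using car by (simp add: assoc_mult_mat[of _ N N _ N _ N])
    then have "(P * S * P * Q) $$ (i, k) = (S * (P * Q)) $$ (i, k)
        - (\<Sum>j<N. (S * (P * Q)) $$ (j, k)) / real N"
      using Pi_mat_mult_index[of "S * (P * Q)" N N i k] i k car by (simp add: P_def)
    also have "\<dots> = l k * u k i - l k * (\<Sum>j<N. u k j) / real N"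
      using i by (simp add: b sum.distrib add_divide_distrib flip: sum_distrib_left)
    \<comment> \<open>For \<open>k = 0\<close> the sum is not zero, but the eigenvalue is.\<close>
    also have "\<dots> = l k * u k i"
      using sum0[of k] k by (cases "k = 0") (auto simp: l_def)
    also have "\<dots> = (\<Sum>j<N. if j = k then l k * u k i else 0)"
      using k by simp
    also have "\<dots> = (\<Sum>j<N. Q $$ (i, j) * D $$ (j, k))"
      using i k by (intro sum.cong) (auto simp: Q_def D_def)
    also have "\<dots> = (Q * D) $$ (i, k)"
      by (rule index_mult_mat_sum[OF car(3,4) i k, symmetric])
    finally show "(P * S * P * Q) $$ (i, k) = (Q * D) $$ (i, k)" .
  qed (use car in auto)

  have QQ: "Q\<^sup>T * Q = 1\<^sub>m N"
  proof (rule eq_matI)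
    fix j k assume "j < dim_row (1\<^sub>m N :: real mat)" "k < dim_col (1\<^sub>m N :: real mat)"
    then have j: "j < N" and k: "k < N" by auto
    have "(Q\<^sup>T * Q) $$ (j, k) = (\<Sum>i<N. Q\<^sup>T $$ (j, i) * Q $$ (i, k))"
      using car j k by (intro index_mult_mat_sum) auto
    also have "\<dots> = (\<Sum>i<N. u j i * u k i)"
      using j k by (intro sum.cong) (auto simp: Q_def)
    finally show "(Q\<^sup>T * Q) $$ (j, k) = 1\<^sub>m N $$ (j, k)"
      using orth j k by simp
  qed (use car in auto)

  have "char_poly (P * S * P) = char_poly D"
    by (rule char_poly_eigenbasis[OF _ car(3,4) QQ eig]) (use car in auto)
  also have "char_poly D = (\<Prod>a\<leftarrow>diag_mat D. [:- a, 1:])"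
    by (rule char_poly_upper_triangular[OF car(4)]) (auto simp: D_def)
  also have "\<dots> = (\<Prod>k\<leftarrow>[0..<N]. [:- l k, 1:])"
    by (rule arg_cong[of _ _ prod_list]) (auto simp: diag_mat_def D_def)
  also have "\<dots> = (\<Prod>k<N. [:- l k, 1:])"
    by (simp add: prod.distinct_set_conv_list[symmetric] atLeast0LessThan)
  \<comment> \<open>One block of indices for each eigenvalue, of sizes 1, \<open>p\<close> and
    \<open>n\<close>.\<close>
  also have "{..<N} = insert 0 ({1..p} \<union> {p+1..<N})"
    using N by auto
  also have "(\<Prod>k\<in>\<dots>. [:- l k, 1:])
      = [:- l 0, 1:] * ((\<Prod>k\<in>{1..p}. [:- l k, 1:]) * (\<Prod>k\<in>{p+1..<N}. [:- l k, 1:]))"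
    by (subst prod.insert, simp, simp, subst prod.union_disjoint) auto
  also have "(\<Prod>k\<in>{1..p}. [:- l k, 1:]) = (\<Prod>k\<in>{1..p}. [:- (1 - e / 2), 1:])"
    by (intro prod.cong) (auto simp: l_def)
  also have "(\<Prod>k\<in>{p+1..<N}. [:- l k, 1:]) = (\<Prod>k\<in>{p+1..<N}. [:e / 2, 1:])"
    by (intro prod.cong) (auto simp: l_def)
  finally show ?thesis
    unfolding P_def using N by (simp add: l_def mult.assoc)
qed

text \<open>The roots \<open>0\<close>, \<open>a\<close>, \<open>b\<close> are distinct and only
  \<open>a\<close> is positive and only \<open>b\<close> negative, so each of the two sums has a
  single term, the order of that root.\<close>

lemma signature_of_char_poly:
  fixes T :: "real mat"
  assumes T: "T \<in> carrier_mat N N"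
    and cp: "char_poly T = [:0, 1:] * [:- a, 1:] ^ p * [:- b, 1:] ^ n"
    and "a > 0" "b < 0" "p \<ge> 1" "n \<ge> 1"
  shows "s_plus T = p" "s_minus T = n"
proof -
  have ev: "eigenvalue T e \<longleftrightarrow> e = 0 \<or> e = a \<or> e = b" for e
    unfolding eigenvalue_root_char_poly[OF T] cp using assms by auto
  have nz: "[:0, 1:] * [:- a, 1:] ^ p * [:- b, 1:] ^ n \<noteq> 0"
    by simp
  have ord0: "order x ([:- y, 1:] ^ m) = 0" if "x \<noteq> y" for x y :: real and m
    using that by (intro order_0I) simp
  have ordX: "order x [:0, 1:] = 0" if "x \<noteq> 0" for x :: real
    using that by (intro order_0I) simp
  have ord_a: "order a (char_poly T) = p"
    unfolding cp using assms(3,4) nz by (simp add: order_mult ord0 ordX del: mult_pCons_left)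
  have ord_b: "order b (char_poly T) = n"
    unfolding cp using assms(3,4) nz by (simp add: order_mult ord0 ordX del: mult_pCons_left)
  have "{e. eigenvalue T e \<and> e > 0} = {a}" "{e. eigenvalue T e \<and> e < 0} = {b}"
    using assms(3,4) by (auto simp: ev)
  then show "s_plus T = p" "s_minus T = n"
    by (simp_all add: s_plus_def s_minus_def ord_a ord_b)
qed

section \<open>Strict triangle inequalities\<close>

text \<open>The first two coordinates, read as a complex number, satisfy a strict inequality since
  the nonzero determinant excludes parallel vectors. The remaining coordinates satisfy the weak one,
  and the triangle inequality in the plane for the pairs of partial norms combines the two.\<close>

lemma strict_triangle_of_planar:
  fixes f g :: "nat \<Rightarrow> real"
  assumes "p \<ge> 2" and "f 1 * g 2 \<noteq> f 2 * g 1"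
  shows "L2_set (\<lambda>m. f m + g m) {1..p} < L2_set f {1..p} + L2_set g {1..p}"
proof -
  define R where "R h = L2_set h {3..p}" for h
  have split: "L2_set h {1..p} = sqrt ((cmod (Complex (h 1) (h 2)))\<^sup>2 + (R h)\<^sup>2)" for h
  proof -
    have "{1..p} = insert 1 (insert 2 {3..p})" using assms(1) by auto
    then have "(\<Sum>m=1..p. (h m)\<^sup>2) = (h 1)\<^sup>2 + (h 2)\<^sup>2 + (\<Sum>m=3..p. (h m)\<^sup>2)" by simp
    then show ?thesis by (simp add: L2_set_def R_def cmod_def sum_nonneg)
  qed
  let ?x = "Complex (f 1) (f 2)" and ?y = "Complex (g 1) (g 2)"
  have "cmod (?x + ?y) \<noteq> cmod ?x + cmod ?y"
  proof
    assume "cmod (?x + ?y) = cmod ?x + cmod ?y"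
    \<comment> \<open>Equality forces the two vectors to be parallel; comparing coordinates makes
      the determinant vanish unless \<open>?x\<close> is zero, and then it vanishes as well.\<close>
    then have eq: "cmod ?x *\<^sub>R ?y = cmod ?y *\<^sub>R ?x" by (simp add: norm_triangle_eq)
    then have 1: "cmod ?x * g 1 = cmod ?y * f 1" and 2: "cmod ?x * g 2 = cmod ?y * f 2"
      by (simp_all add: complex_eq_iff)
    have "cmod ?x * (f 1 * g 2) = f 1 * (cmod ?x * g 2)" by (rule mult.left_commute)
    also have "\<dots> = f 2 * (cmod ?y * f 1)" by (subst 2) (simp only: mult_ac)
    also have "\<dots> = cmod ?x * (f 2 * g 1)" by (subst 1[symmetric]) (simp only: mult_ac)
    finally have "cmod ?x = 0" using assms(2) by simp
    then show False using assms(2) by (simp add: complex_eq_iff)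
  qed
  then have lt: "cmod (?x + ?y) < cmod ?x + cmod ?y"
    using norm_triangle_ineq[of ?x ?y] by linarith
  have "L2_set (\<lambda>m. f m + g m) {1..p} = sqrt ((cmod (?x + ?y))\<^sup>2 + (R (\<lambda>m. f m + g m))\<^sup>2)"
    by (simp only: split complex_add)
  also have "\<dots> < sqrt ((cmod ?x + cmod ?y)\<^sup>2 + (R f + R g)\<^sup>2)"
    unfolding real_sqrt_less_iff
    by (intro add_less_le_mono power_strict_mono power_mono lt)
       (auto simp: R_def L2_set_triangle_ineq)
  also have "\<dots> \<le> L2_set f {1..p} + L2_set g {1..p}"
    unfolding split by (rule real_sqrt_sum_squares_triangle_ineq)
  finally show ?thesis .
qed

text \<open>Finitely many strict inequalities survive a small perturbation, each by continuity at
  0.\<close>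

lemma metric_space_of_strict_triangle:
  fixes E :: "nat \<Rightarrow> nat \<Rightarrow> real"
  assumes "finite X"
    and sym: "\<And>i j. E i j = E j i"
    and pos: "\<And>i j. i \<in> X \<Longrightarrow> j \<in> X \<Longrightarrow> i \<noteq> j \<Longrightarrow> E i j > 0"
    and tri: "\<And>i j k. i \<in> X \<Longrightarrow> j \<in> X \<Longrightarrow> k \<in> X \<Longrightarrow> i \<noteq> j \<Longrightarrow> j \<noteq> k \<Longrightarrow> i \<noteq> k \<Longrightarrow>
      E i k < E i j + E j k"
  shows "\<exists>e d. 0 < e \<and> e < 2 \<and> Metric_space X d \<and>
    (\<forall>i\<in>X. \<forall>j\<in>X. (d i j)\<^sup>2 = (if i = j then 0 else (E i j)\<^sup>2 - e))"
proof -
  \<comment> \<open>The absolute value makes \<open>F\<close> nonnegative for every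
    \<open>e\<close>. For the \<open>e\<close> chosen below it has no effect on pairs of distinct
    points.\<close>
  define F where "F e i j = sqrt \<bar>(E i j)\<^sup>2 - e\<bar>" for e i j
  have lim: "((\<lambda>e. F e i j) \<longlongrightarrow> E i j) (at_right 0)" if "i \<in> X" "j \<in> X" "i \<noteq> j" for i j
  proof -
    have "((\<lambda>e. F e i j) \<longlongrightarrow> sqrt \<bar>(E i j)\<^sup>2 - 0\<bar>) (at_right 0)"
      unfolding F_def by (intro tendsto_intros)
    then show ?thesis using pos[OF that] by simp
  qed
  have "\<forall>\<^sub>F e in at_right 0. \<forall>i\<in>X. \<forall>j\<in>X. \<forall>k\<in>X. i \<noteq> j \<longrightarrow> j \<noteq> k \<longrightarrow> i \<noteq> k \<longrightarrow>
      F e i k < F e i j + F e j k"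
  proof (intro eventually_ball_finite ballI assms(1))
    fix i j k assume ijk: "i \<in> X" "j \<in> X" "k \<in> X"
    show "\<forall>\<^sub>F e in at_right 0. i \<noteq> j \<longrightarrow> j \<noteq> k \<longrightarrow> i \<noteq> k \<longrightarrow> F e i k < F e i j + F e j k"
    proof (cases "i \<noteq> j \<and> j \<noteq> k \<and> i \<noteq> k")
      case True
      have "((\<lambda>e. F e i j + F e j k - F e i k) \<longlongrightarrow> E i j + E j k - E i k) (at_right 0)"
        using True ijk by (intro tendsto_intros lim) auto
      moreover have "0 < E i j + E j k - E i k" using tri[OF ijk] True by simp
      ultimately have "\<forall>\<^sub>F e in at_right 0. 0 < F e i j + F e j k - F e i k"
        by (rule order_tendstoD)
      then show ?thesis by eventually_elim simp
    qed auto
  qed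
  moreover have "\<forall>\<^sub>F e in at_right 0. \<forall>i\<in>X. \<forall>j\<in>X. i \<noteq> j \<longrightarrow> e < (E i j)\<^sup>2"
  proof (intro eventually_ball_finite ballI assms(1))
    fix i j assume ij: "i \<in> X" "j \<in> X"
    show "\<forall>\<^sub>F e in at_right 0. i \<noteq> j \<longrightarrow> e < (E i j)\<^sup>2"
    proof (cases "i = j")
      case False
      then have "\<forall>\<^sub>F e in at_right 0. e \<in> {0<..<(E i j)\<^sup>2}"
        using pos[OF ij] by (intro eventually_at_right_real) simp
      then show ?thesis by eventually_elim simp
    qed auto
  qed
  \<comment> \<open>This bound serves the spectrum: it keeps the eigenvalue \<open>1 - e / 2\<close>
    positive.\<close>
  moreover have "\<forall>\<^sub>F e :: real in at_right 0. e \<in> {0<..<2}"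
    by (intro eventually_at_right_real) simp
  ultimately have "\<forall>\<^sub>F e in at_right 0. (\<forall>i\<in>X. \<forall>j\<in>X. \<forall>k\<in>X. i \<noteq> j \<longrightarrow> j \<noteq> k \<longrightarrow> i \<noteq> k \<longrightarrow>
      F e i k < F e i j + F e j k) \<and> (\<forall>i\<in>X. \<forall>j\<in>X. i \<noteq> j \<longrightarrow> e < (E i j)\<^sup>2) \<and> e \<in> {0<..<2}"
    by (intro eventually_conj)
  from eventually_happens'[OF trivial_limit_at_right_real this]
  obtain e where *: "\<forall>i\<in>X. \<forall>j\<in>X. \<forall>k\<in>X. i \<noteq> j \<longrightarrow> j \<noteq> k \<longrightarrow> i \<noteq> k \<longrightarrow>
      F e i k < F e i j + F e j k" "\<forall>i\<in>X. \<forall>j\<in>X. i \<noteq> j \<longrightarrow> e < (E i j)\<^sup>2" "e \<in> {0<..<2}"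
    by (elim exE conjE)
  have e: "0 < e" "e < 2" using *(3) by auto
  have tri': "F e i k < F e i j + F e j k"
    if "i \<in> X" "j \<in> X" "k \<in> X" "i \<noteq> j" "j \<noteq> k" "i \<noteq> k" for i j k
    using *(1) that by simp
  have less: "e < (E i j)\<^sup>2" if "i \<in> X" "j \<in> X" "i \<noteq> j" for i j
    using *(2) that by simp
  \<comment> \<open>\<open>F\<close> need not vanish on the diagonal, so the distance is reset to 0
    there.\<close>
  define d where "d i j = (if i = j then 0 else F e i j)" for i j
  have nonneg: "F e i j \<ge> 0" for i j by (simp add: F_def)
  have "Metric_space X d"
  proof
    show "0 \<le> d i j" for i j by (simp add: d_def nonneg)
    show "d i j = d j i" for i j by (simp add: d_def F_def sym)
    show "d i j = 0 \<longleftrightarrow> i = j" if "i \<in> X" "j \<in> X" for i j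
      using less[OF that] by (auto simp: d_def F_def)
    show "d i k \<le> d i j + d j k" if "i \<in> X" "j \<in> X" "k \<in> X" for i j k
      using tri'[OF that] nonneg[of i j] nonneg[of j k]
      by (auto simp: d_def F_def sym)
  qed
  moreover have "(d i j)\<^sup>2 = (if i = j then 0 else (E i j)\<^sup>2 - e)" if "i \<in> X" "j \<in> X" for i j
    using less[OF that] by (cases "i = j") (simp_all add: d_def F_def)
  ultimately show ?thesis using e by blast
qed

section \<open>Construction of the metric space\<close>

theorem corollary5p9:
  fixes p n N :: nat
  assumes "p \<ge> 2" and "n \<ge> 1" and "N = n + p + 1"
  shows "\<exists>(X :: nat set) d x.
           Metric_space X d \<and> finite X \<and> card X = N \<and> bij_betw x {..<N} X \<and>
           (let T = Pi_mat N * S_mat N x d * Pi_mat N in s_plus T = p \<and> s_minus T = n)"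
proof -
  obtain q :: "nat \<Rightarrow> real poly" where deg: "\<And>k. k < N \<Longrightarrow> degree (q k) = k" and
    orth: "\<And>j k. j < N \<Longrightarrow> k < N \<Longrightarrow>
      (\<Sum>i<N. poly (q j) (real i) * poly (q k) (real i)) = (if j = k then 1 else 0)"
    using discrete_orthonormal_polys by metis
  define u where "u k i = poly (q k) (real i)" for k i
  define E where "E i j = L2_set (\<lambda>m. u m i - u m j) {1..p}" for i j
  have "degree (q 0) = 0" using deg assms by simp
  then obtain c where "q 0 = [:c:]" by (rule degree_eq_zeroE)
  then have u0: "u 0 i = c" for i by (simp add: u_def)
  obtain a where a: "a \<noteq> 0" "u 1 i - u 1 j = a * (real i - real j)" for i j
  proof
    have "degree (q 1) = 1" using deg assms by simp
    then have *: "poly (q 1) x = coeff (q 1) 0 + coeff (q 1) 1 * x" for x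
      by (simp add: poly_altdef)
    show "u 1 i - u 1 j = coeff (q 1) 1 * (real i - real j)" for i j
      by (simp only: u_def *) (simp add: algebra_simps)
    show "coeff (q 1) 1 \<noteq> 0"
      using \<open>degree (q 1) = 1\<close> by (metis leading_coeff_0_iff degree_0 zero_neq_one)
  qed
  \<comment> \<open>Here \<open>b\<close> is the leading coefficient of \<open>q 2\<close>. Together
    with the affine \<open>u 1\<close>, this places the points on a parabola.\<close>
  obtain b b' where b: "b \<noteq> 0"
    "u 2 i - u 2 j = (real i - real j) * (b * (real i + real j) + b')" for i j
  proof
    have "degree (q 2) = 2" using deg assms by simp
    then have *: "poly (q 2) x = coeff (q 2) 0 + coeff (q 2) 1 * x + coeff (q 2) 2 * x\<^sup>2" for x
      by (simp add: poly_altdef numeral_2_eq_2)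
    show "u 2 i - u 2 j = (real i - real j) * (coeff (q 2) 2 * (real i + real j) + coeff (q 2) 1)"
      for i j
      by (simp only: u_def *) (simp add: algebra_simps power2_eq_square)
    show "coeff (q 2) 2 \<noteq> 0"
      using \<open>degree (q 2) = 2\<close> by (metis leading_coeff_0_iff degree_0 zero_neq_numeral)
  qed

  have "E i j = E j i" for i j
    by (simp add: E_def L2_set_def power2_commute)
  \<comment> \<open>The first coordinate alone separates the points.\<close>
  moreover have "E i j > 0" if "i \<noteq> j" for i j
    unfolding E_def L2_set_def real_sqrt_gt_0_iff
    using assms(1) that a by (intro sum_pos2[of _ 1]) (auto simp del: One_nat_def)
  moreover have "E i k < E i j + E j k" if "i \<noteq> j" "j \<noteq> k" "i \<noteq> k" for i j k
  proof -
    \<comment> \<open>The determinant for three points of the parabola is a Vandermonde product, in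
      which \<open>b'\<close> cancels; it is nonzero for distinct indices.\<close>
    have "(u 1 i - u 1 j) * (u 2 j - u 2 k) - (u 2 i - u 2 j) * (u 1 j - u 1 k)
        = a * b * (real i - real j) * (real j - real k) * (real k - real i)"
      unfolding a b by (simp add: algebra_simps)
    also have "\<dots> \<noteq> 0" using that a(1) b(1) by simp
    finally show ?thesis
      using strict_triangle_of_planar[OF assms(1), of "\<lambda>m. u m i - u m j" "\<lambda>m. u m j - u m k"]
      by (simp add: E_def)
  qed
  \<comment> \<open>The points of the space are the indices themselves, enumerated by
    \<open>id\<close>.\<close>
  ultimately have "\<exists>e d. 0 < e \<and> e < 2 \<and> Metric_space {..<N} d \<and>
    (\<forall>i\<in>{..<N}. \<forall>j\<in>{..<N}. (d i j)\<^sup>2 = (if i = j then 0 else (E i j)\<^sup>2 - e))"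
    by (intro metric_space_of_strict_triangle finite_lessThan)
  then obtain e d where e: "0 < e" "e < 2" and metric: "Metric_space {..<N} d" and
    d: "\<And>i j. i < N \<Longrightarrow> j < N \<Longrightarrow> (d i j)\<^sup>2 = (if i = j then 0 else (E i j)\<^sup>2 - e)"
    unfolding lessThan_iff Ball_def by blast

  define T where "T = Pi_mat N * S_mat N id d * Pi_mat N"
  have S: "S_mat N id d = mat N N (\<lambda>(i, j). - (1 / 2) *
      (if i = j then 0 else (\<Sum>m=1..p. (u m i - u m j)\<^sup>2) - e))"
    unfolding S_mat_def by (intro cong_mat) (auto simp: d E_def L2_set_def sum_nonneg)
  have T: "T \<in> carrier_mat N N"
    unfolding T_def by (intro mult_carrier_mat[of _ N N] Pi_mat_carrier) (simp add: S_mat_def)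
  have "char_poly T = [:0, 1:] * [:- (1 - e / 2), 1:] ^ p * [:- (- e / 2), 1:] ^ n"
    unfolding T_def S using char_poly_centered[of N u c n p e] orth u0 assms(3)
    by (simp add: u_def)
  then have "s_plus T = p" "s_minus T = n"
    using signature_of_char_poly[OF T, of "1 - e / 2" p "- e / 2" n] e assms by auto
  with metric show ?thesis
    by (intro exI[of _ "{..<N}"] exI[of _ d] exI[of _ id]) (simp add: T_def Let_def)
qed

end
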